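(* Let $q$ be a prime power, $s\ge 2$ an odd integer, and $n_1=(q^s+1)n_2$, where $n_2$ is a positive integer dividing $q^s-1$. Let $0=a'_0<a'_1<\dots<a'_{\nu'}$ be the minimum representatives of the cyclotomic cosets modulo $n_1$ with respect to $q^2$, and let $1\le\tau'\le\nu'$. Then the BCH code $\mathrm{BCH}^{n_1}(1,\tau')$ over $\mathbb{F}_{q^2}$ is Hermitian self-orthogonal if and only if $$a'_{\tau'}\le n_2-1.$$
   Context: Let $n_1\mid q^{2s}-1$ and $E(n_1)=\{0,1,\dots,n_1-1\}$, regarded as a set of representatives of $\mathbb{Z}/n_1\mathbb{Z}$. The cyclotomic cosets in $E(n_1)$ with respect to $q^2$ are the sets $\{q^{2i}e\bmod n_1: i\ge 0\}$, $e\in E(n_1)$; $\Lambda'_a$ denotes the coset with minimum element $a$. Let $U(n_1)=\{\beta_1,\dots,\beta_{n_1}\}\subset\mathbb{F}_{q^{2s}}$ be the zeros of $X^{n_1}-1$, and for $\Delta\subseteq E(n_1)$ let $\mathcal{C}^{U(n_1)}_\Delta\subseteq\mathbb{F}_{q^{2s}}^{n_1}$ be the $\mathbb{F}_{q^{2s}}$-span of the vectors $(\beta_1^e,\dots,\beta_{n_1}^e)$, $e\in\Delta$. Then $\mathrm{BCH}^{n_1}(1,\tau')=\mathcal{C}^{U(n_1)}_{\Delta}\cap\mathbb{F}_{q^2}^{n_1}$ with $\Delta=\Lambda'_{a'_1}\cup\dots\cup\Lambda'_{a'_{\tau'}}$. A linear code $\mathcal{C}\subseteq\mathbb{F}_{q^2}^{n_1}$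 is Hermitian self-orthogonal if $\sum_i x_iy_i^q=0$ for all $\boldsymbol{x},\boldsymbol{y}\in\mathcal{C}$. *)

theory Defs
  imports "HOL-Analysis.Cartesian_Space" "HOL-Number_Theory.Prime_Powers"
begin

definition cyclotomic_coset :: "nat \<Rightarrow> nat \<Rightarrow> nat \<Rightarrow> nat set" where
  "cyclotomic_coset Q n e = {Q ^ i * e mod n | i. True}"

definition cyclotomic_cosets :: "nat \<Rightarrow> nat \<Rightarrow> nat set set" where
  "cyclotomic_cosets Q n = cyclotomic_coset Q n ` {0..<n}"

definition min_representatives :: "nat \<Rightarrow> nat \<Rightarrow> nat set" where
  "min_representatives Q n = Min ` cyclotomic_cosets Q n"

text \<open>The coset \<open>\<Lambda>'\<^sub>a\<close>; meaningful when \<open>a \<in> min_representatives Q n\<close>, in which case it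
  exists and is unique because the cosets partition \<open>{0..<n}\<close> (for \<open>Q\<close> coprime to \<open>n\<close>).\<close>

definition coset_with_min :: "nat \<Rightarrow> nat \<Rightarrow> nat \<Rightarrow> nat set" where
  "coset_with_min Q n a = (THE \<Lambda>. \<Lambda> \<in> cyclotomic_cosets Q n \<and> Min \<Lambda> = a)"

definition is_subfield :: "'a::field set \<Rightarrow> bool" where
  "is_subfield K \<longleftrightarrow> 0 \<in> K \<and> 1 \<in> K \<and>
     (\<forall>x\<in>K. \<forall>y\<in>K. x + y \<in> K \<and> x * y \<in> K) \<and>
     (\<forall>x\<in>K. - x \<in> K \<and> inverse x \<in> K)"

text \<open>Codes of length \<open>n\<close> are sets of vectors in \<open>'a ^ 'n\<close> with \<open>CARD('n) = n\<close>. The family \<open>\<beta>\<close>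
  enumerates the evaluation points; \<open>vec.span\<close> is the span over the whole field \<open>'a\<close>.\<close>

definition evaluation_code :: "('n::finite \<Rightarrow> 'a::field) \<Rightarrow> nat set \<Rightarrow> ('a ^ 'n) set" where
  "evaluation_code \<beta> \<Delta> = vec.span ((\<lambda>e. \<chi> i. \<beta> i ^ e) ` \<Delta>)"

text \<open>The code \<open>BCH\<^sup>n(t,t')\<close> over the subfield \<open>K\<close> of \<open>'a\<close>, where \<open>n = CARD('n)\<close>, \<open>Q\<close> is the order
  of \<open>K\<close>, and \<open>a\<close> lists the minimum representatives.\<close>

definition bch_code ::
  "'a::field set \<Rightarrow> nat \<Rightarrow> ('n::finite \<Rightarrow> 'a) \<Rightarrow> (nat \<Rightarrow> nat) \<Rightarrow> nat \<Rightarrow> nat \<Rightarrow> ('a ^ 'n) set" where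
  "bch_code K Q \<beta> a t t' =
     evaluation_code \<beta> (\<Union>j\<in>{t..t'}. coset_with_min Q CARD('n) (a j)) \<inter> {x. \<forall>i. x $ i \<in> K}"

definition hermitian_self_orthogonal :: "nat \<Rightarrow> ('a::field ^ 'n::finite) set \<Rightarrow> bool" where
  "hermitian_self_orthogonal q C \<longleftrightarrow> (\<forall>x\<in>C. \<forall>y\<in>C. (\<Sum>i\<in>UNIV. x $ i * (y $ i) ^ q) = 0)"

end

theory Submission
  imports Defs "HOL-Number_Theory.Cong" "HOL-Computational_Algebra.Polynomial"
begin

text \<open>For subsets \<open>\<Delta>\<close> closed under multiplication by \<open>q\<^sup>2\<close>, the BCH code is Hermitian
  self-orthogonal iff no \<open>e, f \<in> \<Delta>\<close> satisfy \<open>n\<^sub>1 dvd e + q f\<close>: the sum of \<open>\<beta>\<^sup>m\<close> over all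
  \<open>\<beta>\<close> with \<open>\<beta>\<^bsup>n\<^sub>1\<^esup> = 1\<close> vanishes unless \<open>n\<^sub>1 dvd m\<close>, and the code contains the trace vectors
  \<open>Tr (c \<beta>\<^sup>e)\<close> for all \<open>c\<close>, so that the Hermitian form of two of them is a polynomial in the
  scalars, of degree below the field size, whose coefficients are these sums.
  If \<open>a \<tau> \<ge> n2\<close>, then \<open>\<Delta>\<close> contains the coset of \<open>n2\<close>, and \<open>n2 + q\<^sup>s n2 = n1\<close> with \<open>s\<close> odd gives
  a bad pair. If \<open>a \<tau> < n2\<close>, a bad pair can be multiplied by a power of \<open>q\<close> to give
  \<open>n1 dvd a + q\<^sup>m b\<close> with \<open>0 < a, b < n2\<close> and \<open>m \<le> s\<close>, but \<open>0 < a + q\<^sup>m b < n1\<close>.\<close>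

subsection \<open>Finite fields\<close>

lemma prime_CHAR_finite: "prime CHAR('a::{field,finite})"
  by (intro prime_CHAR_semidom finite_imp_CHAR_pos) simp

text \<open>Translation by 1 permutes the field, so the sum of 1 over all elements vanishes and the
  characteristic divides the cardinality.\<close>

lemma CHAR_eq_of_card_prime_power:
  assumes "prime p" "CARD('a::{field,finite}) = p ^ k"
  shows "CHAR('a) = p"
proof -
  have "(\<Sum>x\<in>UNIV. x + 1 :: 'a) = (\<Sum>x\<in>UNIV. x)"
    by (rule sum.reindex_bij_witness[of _ "\<lambda>x. x - 1" "\<lambda>x. x + 1"]) auto
  then have "of_nat CARD('a) = (0::'a)"
    by (simp add: sum.distrib)
  then have "CHAR('a) dvd p ^ k"
    by (simp only: of_nat_eq_0_iff_char_dvd assms(2))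
  then have "CHAR('a) dvd p"
    using prime_CHAR_finite[where 'a = 'a] prime_dvd_power by blast
  then show ?thesis
    using assms(1) prime_CHAR_finite[where 'a = 'a] primes_dvd_imp_eq by blast
qed

text \<open>Multiplication by a nonzero \<open>x\<close> permutes \<open>K - {0}\<close>; cancelling
  the product of all its elements leaves a power of \<open>x\<close> equal to 1.\<close>

lemma subfield_power_card:
  fixes x :: "'a::{field,finite}"
  assumes "is_subfield K" "x \<in> K"
  shows "x ^ card K = x"
proof (cases "x = 0")
  case True
  moreover have "card K > 0"
    using assms(2) by (auto simp: card_gt_0_iff)
  ultimately show ?thesis by simp
next
  case False
  have mult: "u * v \<in> K" if "u \<in> K" "v \<in> K" for u v
    using assms(1) that by (auto simp: is_subfield_def)
  have div: "v / x \<in> K" if "v \<in> K" for v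
    using assms that by (auto simp: is_subfield_def divide_inverse)
  have "0 \<in> K" using assms(1) by (auto simp: is_subfield_def)
  have "(\<Prod>y\<in>K-{0}. x * y) = (\<Prod>y\<in>K-{0}. y)"
    by (rule prod.reindex_bij_witness[of _ "\<lambda>y. y / x" "\<lambda>y. x * y"])
      (use False assms(2) mult div in auto)
  then have "x ^ card (K - {0}) * (\<Prod>y\<in>K-{0}. y) = (\<Prod>y\<in>K-{0}. y)"
    by (simp add: prod.distrib)
  then have "x ^ card (K - {0}) = 1" by simp
  moreover have "card K = Suc (card (K - {0}))"
    using \<open>0 \<in> K\<close> by (metis card_Suc_Diff1 finite)
  ultimately show ?thesis by simp
qed

lemma power_card_UNIV:
  fixes x :: "'a::{field,finite}"
  shows "x ^ CARD('a) = x"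
  by (rule subfield_power_card) (auto simp: is_subfield_def)

text \<open>A polynomial of degree below the field size with every field element as a root is zero.
  Injectivity of \<open>m\<close> keeps the monomials from merging, so each coefficient can be read
  off.\<close>

lemma coeffs_zero_of_vanishing:
  fixes A :: "'i \<Rightarrow> 'a::{field,finite}"
  assumes "finite I" "inj_on m I" "\<And>k. k \<in> I \<Longrightarrow> m k < CARD('a)"
    and "\<And>x. (\<Sum>k\<in>I. A k * x ^ m k) = 0" and "k \<in> I"
  shows "A k = 0"
proof -
  define P where "P = (\<Sum>k\<in>I. monom (A k) (m k))"
  have "degree P < CARD('a)"
    unfolding P_def
    by (intro degree_sum_less) (use assms(3) in \<open>auto intro: le_less_trans[OF degree_monom_le]\<close>)
  moreover have "poly P x = 0" for x
    using assms(4) by (simp add: P_def poly_sum poly_monom)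
  ultimately have "P = 0"
    by (intro poly_eqI_degree[of UNIV]) auto
  then have "0 = coeff P (m k)" by simp
  also have "\<dots> = (\<Sum>j\<in>I. if j = k then A j else 0)"
    unfolding P_def coeff_sum
    by (intro sum.cong refl) (use assms(2,5) in \<open>auto dest: inj_onD\<close>)
  also have "\<dots> = A k" using assms(1,5) by simp
  finally show ?thesis by simp
qed

text \<open>Every element of \<open>K\<close> is a root of X^|K| - X, which has at most |K| roots,
  so \<open>K\<close> exhausts them.\<close>

lemma subfield_memI:
  fixes x :: "'a::{field,finite}"
  assumes "is_subfield K" "x ^ card K = x"
  shows "x \<in> K"
proof -
  \<comment> \<open>With at least two elements in \<open>K\<close>, the term X^|K| dominates X and
    fixes the degree of \<open>P\<close>.\<close>
  have "card {0::'a, 1} \<le> card K"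
    using assms(1) by (intro card_mono) (auto simp: is_subfield_def)
  then have 2: "card K \<ge> 2" by simp
  define P where "P = monom 1 (card K) + [:0, -1::'a:]"
  have deg: "degree P = card K"
    unfolding P_def using 2 by (subst degree_add_eq_left) (auto simp: degree_monom_eq)
  then have "P \<noteq> 0" using 2 by auto
  have roots: "{x. poly P x = 0} = {x. x ^ card K = x}"
    by (auto simp: P_def poly_monom)
  have "K = {x. x ^ card K = x}"
    using card_poly_roots_bound[OF \<open>P \<noteq> 0\<close>] subfield_power_card[OF assms(1)]
    by (intro card_seteq) (auto simp: roots deg)
  then show ?thesis using assms(2) by blast
qed

text \<open>Raising to the power |K| is additive and shifts the summands cyclically, since z^(|K|^s)
  = z; hence the trace is fixed by it.\<close>

lemma trace_in_subfield:
  fixes z :: "'a::{field,finite}"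
  assumes "is_subfield K" "card K = CHAR('a) ^ k" "CARD('a) = card K ^ s"
  shows "(\<Sum>i<s. z ^ (card K ^ i)) \<in> K"
proof (rule subfield_memI[OF assms(1)])
  have "(\<Sum>i<s. z ^ (card K ^ i)) ^ card K = (\<Sum>i<s. z ^ (card K ^ Suc i))"
    by (simp add: freshmans_dream_sum'[OF prime_CHAR_finite assms(2)] mult.commute
        flip: power_mult)
  also have "\<dots> = (\<Sum>i<s. z ^ (card K ^ i))"
    using sum.lessThan_Suc_shift[of "\<lambda>i. z ^ (card K ^ i)" s] power_card_UNIV[of z]
    by (simp add: assms(3))
  finally show "(\<Sum>i<s. z ^ (card K ^ i)) ^ card K = (\<Sum>i<s. z ^ (card K ^ i))" .
qed

subsection \<open>Roots of unity\<close>

lemma power_mod_exponent: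
  fixes x :: "'a::monoid_mult"
  assumes "x ^ n = 1"
  shows "x ^ (m mod n) = x ^ m"
proof -
  have "x ^ m = x ^ (n * (m div n) + m mod n)" by simp
  also have "\<dots> = x ^ (m mod n)" by (simp only: power_add power_mult assms) simp
  finally show ?thesis by simp
qed

text \<open>If some root of unity \<open>g\<close> has \<open>g ^ m\<close> different from 1, then
  multiplication by \<open>g\<close> permutes the roots and scales the sum by \<open>g ^ m\<close>,
  which forces it to be 0.\<close>

lemma sum_powers_roots_of_unity:
  fixes m n :: nat
  assumes "n > 0" "card {x::'a::field. x ^ n = 1} = n"
  shows "(\<Sum>x | x ^ n = (1::'a). x ^ m) = (if n dvd m then of_nat n else 0)"
proof (cases "n dvd m")
  case True
  then obtain k where "m = n * k" by blast
  then have "(\<Sum>x | x ^ n = (1::'a). x ^ m) = (\<Sum>x | x ^ n = (1::'a). 1)"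
    by (intro sum.cong) (auto simp: power_mult)
  then show ?thesis using True assms(2) by simp
next
  case False
  let ?S = "{x::'a. x ^ n = 1}"
  have r: "m mod n > 0" using False by (auto simp: dvd_eq_mod_eq_0)
  \<comment> \<open>Otherwise all \<open>n\<close> roots would be zeros of X^(m mod n) - 1, whose
    degree is positive but below \<open>n\<close>.\<close>
  have "\<exists>g\<in>?S. g ^ m \<noteq> 1"
  proof (rule ccontr)
    assume "\<not> ?thesis"
    then have "?S \<subseteq> {x. x ^ (m mod n) = 1}"
      by (auto simp: power_mod_exponent)
    define P where "P = monom 1 (m mod n) + [:-1::'a:]"
    have deg: "degree P = m mod n"
      unfolding P_def using r by (subst degree_add_eq_left) (auto simp: degree_monom_eq)
    then have "P \<noteq> 0" using r by auto
    have "?S \<subseteq> {x. poly P x = 0}"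
      using \<open>?S \<subseteq> {x. x ^ (m mod n) = 1}\<close> by (auto simp: P_def poly_monom)
    from card_mono[OF poly_roots_finite[OF \<open>P \<noteq> 0\<close>] this] have "n \<le> degree P"
      using card_poly_roots_bound[OF \<open>P \<noteq> 0\<close>] by (simp only: assms(2) le_trans)
    then show False using deg mod_less_divisor[OF assms(1), of m] by simp
  qed
  then obtain g :: 'a where g: "g ^ n = 1" "g ^ m \<noteq> 1" by blast
  then have "g \<noteq> 0" using assms(1) by (auto simp: power_0_left)
  have "(\<Sum>x\<in>?S. x ^ m) = (\<Sum>x\<in>?S. (g * x) ^ m)"
    by (rule sum.reindex_bij_witness[of _ "\<lambda>x. g * x" "\<lambda>x. x / g"])
      (use g \<open>g \<noteq> 0\<close> in \<open>auto simp: power_mult_distrib power_divide\<close>)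
  also have "\<dots> = g ^ m * (\<Sum>x\<in>?S. x ^ m)"
    by (simp add: power_mult_distrib sum_distrib_left)
  finally have "(\<Sum>x\<in>?S. x ^ m) = 0" using g(2) by simp
  then show ?thesis using False by simp
qed

lemma sum_evaluation_powers:
  fixes \<beta> :: "'n::finite \<Rightarrow> 'a::field"
  assumes "bij_betw \<beta> UNIV {x. x ^ CARD('n) = 1}"
  shows "(\<Sum>i\<in>UNIV. \<beta> i ^ m) = (if CARD('n) dvd m then of_nat CARD('n) else 0)"
proof -
  have "(\<Sum>i\<in>UNIV. \<beta> i ^ m) = (\<Sum>x | x ^ CARD('n) = (1::'a). x ^ m)"
    by (rule sum.reindex_bij_betw[OF assms])
  also have "\<dots> = (if CARD('n) dvd m then of_nat CARD('n) else 0)"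
    using bij_betw_same_card[OF assms] by (intro sum_powers_roots_of_unity) auto
  finally show ?thesis .
qed

subsection \<open>Cyclotomic cosets\<close>

lemma finite_cyclotomic_coset: "n > 0 \<Longrightarrow> finite (cyclotomic_coset Q n e)"
  by (rule finite_subset[of _ "{..<n}"]) (auto simp: cyclotomic_coset_def)

lemma cyclotomic_coset_eqI:
  assumes "[Q ^ s = 1] (mod n)" "s > 0" "x \<in> cyclotomic_coset Q n e"
  shows "cyclotomic_coset Q n x = cyclotomic_coset Q n e"
proof -
  obtain i where x: "x = Q ^ i * e mod n"
    using assms(3) by (auto simp: cyclotomic_coset_def)
  have "Q ^ k * x mod n = Q ^ (k + i) * e mod n" for k
    unfolding x by (simp add: mod_simps power_add mult_ac)
  \<comment> \<open>As Q^s = 1 modulo \<open>n\<close>, the factor Q^(s-1) inverts Q; applying it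
    \<open>i\<close> times leads back from \<open>x\<close> to \<open>e\<close>.\<close>
  moreover have "Q ^ k * e mod n = Q ^ (k + i * (s - 1)) * x mod n" for k
  proof -
    have "k + i * (s - 1) + i = k + s * i"
      using assms(2) by (cases s) (auto simp: algebra_simps)
    then have "Q ^ (k + i * (s - 1)) * x mod n = Q ^ (k + s * i) * e mod n"
      using calculation[of "k + i * (s - 1)"] by (simp only:)
    also have "[Q ^ (k + s * i) * e = Q ^ k * 1 ^ i * e] (mod n)"
      unfolding power_add power_mult
      by (intro cong_mult cong_pow assms(1) cong_refl)
    then have "Q ^ (k + s * i) * e mod n = Q ^ k * e mod n"
      by (simp add: cong_def)
    finally show ?thesis by simp
  qed
  ultimately show ?thesis unfolding cyclotomic_coset_def by blast
qed

text \<open>A coset contains its minimum and is generated by any of its elements, so the definite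
  description has exactly one candidate.\<close>

lemma coset_with_min_eq:
  assumes "[Q ^ s = 1] (mod n)" "s > 0" "n > 0" "a \<in> min_representatives Q n"
  shows "coset_with_min Q n a = cyclotomic_coset Q n a"
proof -
  have eq: "cyclotomic_coset Q n a = \<Lambda>" if "\<Lambda> \<in> cyclotomic_cosets Q n" "Min \<Lambda> = a" for \<Lambda>
  proof -
    from that(1) obtain e where e: "\<Lambda> = cyclotomic_coset Q n e"
      by (auto simp: cyclotomic_cosets_def)
    have "\<Lambda> \<noteq> {}" by (auto simp: e cyclotomic_coset_def)
    then have "a \<in> \<Lambda>"
      by (metis Min_in that(2) e finite_cyclotomic_coset[OF assms(3)])
    then show ?thesis using cyclotomic_coset_eqI[OF assms(1,2)] e by blast
  qed
  obtain \<Lambda> where "\<Lambda> \<in> cyclotomic_cosets Q n" "Min \<Lambda> = a"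
    using assms(4) by (auto simp: min_representatives_def)
  then show ?thesis
    unfolding coset_with_min_def using eq by (intro the_equality) auto
qed

subsection \<open>Hermitian orthogonality of evaluation codes\<close>

text \<open>The form is linear in \<open>x\<close> and, as \<open>q\<close> is a power of the
  characteristic, semilinear in \<open>y\<close>. It therefore suffices to test generators, where it
  is the power sum with exponent \<open>e + q * f\<close>.\<close>

lemma evaluation_code_hermitian_orthogonal:
  fixes \<beta> :: "'n::finite \<Rightarrow> 'a::{field,finite}"
  assumes "q = CHAR('a) ^ k"
    and "bij_betw \<beta> UNIV {x. x ^ CARD('n) = 1}"
    and "\<And>e f. e \<in> \<Delta> \<Longrightarrow> f \<in> \<Delta> \<Longrightarrow> \<not> CARD('n) dvd e + q * f"
  shows "hermitian_self_orthogonal q (evaluation_code \<beta> \<Delta>)"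
  unfolding hermitian_self_orthogonal_def
proof (intro ballI)
  fix x y assume x: "x \<in> evaluation_code \<beta> \<Delta>" and y: "y \<in> evaluation_code \<beta> \<Delta>"
  have "q > 0"
    using assms(1) prime_gt_0_nat[OF prime_CHAR_finite[where 'a = 'a]] by simp
  have y_orth: "(\<Sum>i\<in>UNIV. \<beta> i ^ e * (y $ i) ^ q) = 0" if "e \<in> \<Delta>" for e
    using y unfolding evaluation_code_def
  proof (induction rule: vec.span_induct_alt)
    case base
    show ?case using \<open>q > 0\<close> by (simp add: power_0_left)
  next
    case (step c v z)
    then obtain f where f: "f \<in> \<Delta>" "v = (\<chi> i. \<beta> i ^ f)" by blast
    have "(\<Sum>i\<in>UNIV. \<beta> i ^ e * (v $ i) ^ q) = (\<Sum>i\<in>UNIV. \<beta> i ^ (e + q * f))"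
      by (simp add: f(2) power_add mult.commute[of q] power_mult)
    also have "\<dots> = 0"
      using assms(3)[OF that f(1)] by (simp add: sum_evaluation_powers[OF assms(2)])
    finally have v: "(\<Sum>i\<in>UNIV. \<beta> i ^ e * (v $ i) ^ q) = 0" .
    have "(\<Sum>i\<in>UNIV. \<beta> i ^ e * ((c *s v + z) $ i) ^ q)
        = (\<Sum>i\<in>UNIV. c ^ q * (\<beta> i ^ e * (v $ i) ^ q) + \<beta> i ^ e * (z $ i) ^ q)"
      by (simp add: freshmans_dream'[OF prime_CHAR_finite assms(1)] power_mult_distrib
          algebra_simps)
    also have "\<dots> = 0"
      using step(2) v by (simp add: sum.distrib flip: sum_distrib_left)
    finally show ?case .
  qed
  show "(\<Sum>i\<in>UNIV. x $ i * (y $ i) ^ q) = 0"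
    using x unfolding evaluation_code_def
  proof (induction rule: vec.span_induct_alt)
    case base
    show ?case by simp
  next
    case (step c v z)
    then obtain e where e: "e \<in> \<Delta>" "v = (\<chi> i. \<beta> i ^ e)" by blast
    have "(\<Sum>i\<in>UNIV. (c *s v + z) $ i * (y $ i) ^ q)
        = (\<Sum>i\<in>UNIV. c * (\<beta> i ^ e * (y $ i) ^ q) + z $ i * (y $ i) ^ q)"
      by (simp add: e(2) algebra_simps)
    also have "\<dots> = 0"
      using step(2) y_orth[OF e(1)] by (simp add: sum.distrib flip: sum_distrib_left)
    finally show ?case .
  qed
qed

text \<open>Distributing the powers turns the trace into a combination of generators with exponents
  in the coset of \<open>e\<close>, with coefficients \<open>c ^ (Q ^ k)\<close>.\<close>

lemma trace_vector_in_evaluation_code: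
  fixes \<beta> :: "'n::finite \<Rightarrow> 'a::field"
  assumes "\<And>i. \<beta> i ^ CARD('n) = 1" "cyclotomic_coset Q CARD('n) e \<subseteq> \<Delta>"
  shows "(\<chi> i. \<Sum>k<s. (c * \<beta> i ^ e) ^ (Q ^ k)) \<in> evaluation_code \<beta> \<Delta>"
proof -
  have "(\<chi> i. \<Sum>k<s. (c * \<beta> i ^ e) ^ (Q ^ k))
      = (\<Sum>k<s. c ^ (Q ^ k) *s (\<chi> i. \<beta> i ^ (Q ^ k * e mod CARD('n))))"
    by (simp add: vec_eq_iff power_mult_distrib power_mod_exponent[OF assms(1)]
        mult.commute[of _ e] power_mult)
  also have "\<dots> \<in> evaluation_code \<beta> \<Delta>"
    unfolding evaluation_code_def
    by (intro vec.span_sum vec.span_scale vec.span_base)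
      (use assms(2) in \<open>auto simp: cyclotomic_coset_def\<close>)
  finally show ?thesis .
qed

text \<open>The form of the trace vectors for \<open>c\<close> and \<open>d\<close> is a polynomial
  in both scalars. Extracting first the coefficient of \<open>c\<close> and then that of
  \<open>d ^ (Q ^ l * q)\<close> leaves a power sum whose value is the length, a nonzero field
  element.\<close>

lemma trace_vectors_not_orthogonal:
  fixes \<beta> :: "'n::finite \<Rightarrow> 'a::{field,finite}"
  assumes q: "q = CHAR('a) ^ h" "q > 1" and Q: "Q = q ^ 2" and card: "CARD('a) = Q ^ s"
    and \<beta>: "bij_betw \<beta> UNIV {x. x ^ CARD('n) = 1}"
    and nz: "of_nat CARD('n) \<noteq> (0::'a)"
    and l: "l < s" and dvd: "CARD('n) dvd e + q * (Q ^ l * e)"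
    and C: "\<And>c. (\<chi> i. \<Sum>k<s. (c * \<beta> i ^ e) ^ (Q ^ k)) \<in> C"
  shows "\<not> hermitian_self_orthogonal q C"
proof
  assume orth: "hermitian_self_orthogonal q C"
  have "Q > 1" using q(2) Q one_less_power[of q 2] by simp
  define S where "S m = (\<Sum>i\<in>UNIV. \<beta> i ^ m)" for m
  \<comment> \<open>\<open>A d k\<close> is the coefficient of \<open>c ^ (Q ^ k)\<close>, itself a
    polynomial in \<open>d\<close>.\<close>
  define A where "A d k = (\<Sum>j<s. S (Q ^ k * e + q * (Q ^ j * e)) * d ^ (Q ^ j * q))" for d :: 'a and k
  have "(\<Sum>k<s. A d k * c ^ (Q ^ k)) = 0" for c d
  proof -
    have "0 = (\<Sum>i\<in>UNIV. (\<Sum>k<s. (c * \<beta> i ^ e) ^ (Q ^ k)) * (\<Sum>j<s. (d * \<beta> i ^ e) ^ (Q ^ j)) ^ q)"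
      using orth C[of c] C[of d] unfolding hermitian_self_orthogonal_def by fastforce
    also have "\<dots> = (\<Sum>i\<in>UNIV. \<Sum>k<s. \<Sum>j<s.
        \<beta> i ^ (Q ^ k * e + q * (Q ^ j * e)) * d ^ (Q ^ j * q) * c ^ (Q ^ k))"
      unfolding freshmans_dream_sum'[OF prime_CHAR_finite q(1)] sum_product
      by (intro sum.cong refl)
        (simp add: power_mult_distrib power_add mult_ac flip: power_mult)
    also have "\<dots> = (\<Sum>k<s. A d k * c ^ (Q ^ k))"
      unfolding A_def S_def sum_distrib_right
      by (subst sum.swap, intro sum.cong refl, subst sum.swap) simp
    finally show ?thesis by simp
  qed
  then have vanish: "(\<Sum>k\<in>{..<s}. A d k * c ^ (Q ^ k)) = 0" for c d .
  have A0: "A d 0 = 0" for d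
    by (rule coeffs_zero_of_vanishing[of "{..<s}" "\<lambda>k. Q ^ k" "A d", OF _ _ _ vanish])
      (use l \<open>Q > 1\<close> in \<open>auto simp: card inj_on_def intro: power_strict_increasing\<close>)
  \<comment> \<open>The degrees in \<open>d\<close> carry an extra factor \<open>q\<close>; they
    stay below the field size because \<open>q < Q\<close>.\<close>
  have "q * Q ^ k < Q ^ s" if "k < s" for k
  proof -
    have "q * Q ^ k < Q * Q ^ k" using \<open>Q > 1\<close> q(2) by (simp add: Q power2_eq_square)
    also have "\<dots> \<le> Q ^ s" using that \<open>Q > 1\<close> by (simp flip: power_Suc add: power_increasing)
    finally show ?thesis .
  qed
  then have "S (Q ^ 0 * e + q * (Q ^ l * e)) = 0"
    by (intro coeffs_zero_of_vanishing[of "{..<s}" "\<lambda>k. Q ^ k * q"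
          "\<lambda>j. S (Q ^ 0 * e + q * (Q ^ j * e))" l, OF _ _ _ A0[unfolded A_def]])
      (use l \<open>Q > 1\<close> q(2) in \<open>auto simp: card inj_on_def mult.commute\<close>)
  then show False using dvd nz by (simp add: S_def sum_evaluation_powers[OF \<beta>])
qed

subsection \<open>Pairs of exponents with divisible combination\<close>

lemma not_dvd_pair_sum_le:
  fixes q s d a b m :: nat
  assumes "m \<le> s" "q > 0" "0 < a" "a < d" "b < d"
  shows "\<not> (q ^ s + 1) * d dvd a + q ^ m * b"
proof
  assume "(q ^ s + 1) * d dvd a + q ^ m * b"
  then have "(q ^ s + 1) * d \<le> a + q ^ m * b" using assms(3) by (intro dvd_imp_le) auto
  also have "\<dots> \<le> a + q ^ s * b" using assms by (simp add: power_increasing)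
  also have "\<dots> < d + q ^ s * d" using assms by (intro add_less_le_mono) auto
  finally show False by (simp add: algebra_simps)
qed

text \<open>Since \<open>q\<close> is invertible modulo \<open>n\<close>, the first exponent can be
  made 0 and the second reduced to some \<open>m < 2 * s\<close>. The size bound then applies
  directly, or after exchanging the roles of \<open>a\<close> and \<open>b\<close>.\<close>

lemma not_dvd_pair_sum:
  fixes q s d n a b u v :: nat
  assumes n: "n = (q ^ s + 1) * d" and one: "[q ^ (2 * s) = 1] (mod n)" and "q > 0" "s > 0"
    and ab: "0 < a" "a < d" "0 < b" "b < d"
  shows "\<not> n dvd q ^ u * a + q ^ v * b"
proof
  assume dvd: "n dvd q ^ u * a + q ^ v * b"
  have red: "[q ^ (2 * s * k + j) = q ^ j] (mod n)" for k j
    using cong_mult[OF cong_pow[OF one, of k] cong_refl[of "q ^ j"]]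
    by (simp add: power_add power_mult)
  \<comment> \<open>Multiplying by q^((2s-1)u) raises the first exponent to the multiple 2su of 2s
    and the second to \<open>w\<close>.\<close>
  define w where "w = v + (2 * s - 1) * u"
  define m where "m = w mod (2 * s)"
  have "n dvd q ^ ((2 * s - 1) * u) * (q ^ u * a + q ^ v * b)"
    using dvd by simp
  also have "\<dots> = q ^ (2 * s * u + 0) * a + q ^ (2 * s * (w div (2 * s)) + m) * b"
  proof -
    have "(2 * s - 1) * u + u = 2 * s * u"
      using \<open>s > 0\<close> by (cases s) (auto simp: algebra_simps)
    then have "q ^ ((2 * s - 1) * u) * q ^ u = q ^ (2 * s * u)"
      by (metis power_add)
    moreover have "q ^ ((2 * s - 1) * u) * q ^ v = q ^ (2 * s * (w div (2 * s)) + m)"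
      by (simp add: m_def w_def add.commute flip: power_add)
    ultimately show ?thesis
      by (simp add: distrib_left mult.assoc[symmetric])
  qed
  finally have 1: "n dvd a + q ^ m * b"
    using cong_add[OF cong_mult[OF red[of u 0] cong_refl[of a]]
        cong_mult[OF red[of "w div (2 * s)" m] cong_refl[of b]]]
    by (metis cong_dvd_iff mult_1 power_0)
  show False
  proof (cases "m \<le> s")
    case True
    then show False using not_dvd_pair_sum_le[of m s q a d b] 1 ab \<open>q > 0\<close> by (simp add: n)
  next
    case False
    \<comment> \<open>Multiplying by q^(2s-m) moves the power from \<open>b\<close> to
      \<open>a\<close>, now with an exponent of at most \<open>s\<close>.\<close>
    then have "2 * s - m \<le> s" by simp
    have "m < 2 * s" using \<open>s > 0\<close> by (simp add: m_def)
    have "n dvd q ^ (2 * s - m) * (a + q ^ m * b)"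
      using 1 by simp
    also have "\<dots> = q ^ (2 * s - m) * a + q ^ (2 * s) * b"
      using \<open>m < 2 * s\<close> by (simp add: distrib_left mult.assoc[symmetric] flip: power_add)
    also have "[\<dots> = q ^ (2 * s - m) * a + 1 * b] (mod n)"
      by (intro cong_add cong_mult one cong_refl)
    finally (cong_dvd_iff[THEN iffD1, rotated]) have "n dvd b + q ^ (2 * s - m) * a"
      by (simp add: add.commute)
    then show False
      using not_dvd_pair_sum_le[of "2 * s - m" s q b d a] \<open>2 * s - m \<le> s\<close> ab \<open>q > 0\<close> by (simp add: n)
  qed
qed

section \<open>The criterion in terms of minimum representatives\<close>

theorem proposition3p2:
  fixes q s n1 n2 \<nu> \<tau> :: nat
    and a :: "nat \<Rightarrow> nat"
    and K :: "'a::{field,finite} set"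
    and \<beta> :: "'n::finite \<Rightarrow> 'a"
  assumes "primepow q"
    and "s \<ge> 2" and "odd s"
    and "n2 > 0" and "n2 dvd q ^ s - 1"
    and "n1 = (q ^ s + 1) * n2"
    and "CARD('a) = q ^ (2 * s)"
    and "is_subfield K" and "card K = q ^ 2"
    and "CARD('n) = n1"
    and "bij_betw \<beta> UNIV {x. x ^ n1 = 1}"
    and "a 0 = 0" and "strict_mono_on {0..\<nu>} a"
    and "a ` {0..\<nu>} = min_representatives (q ^ 2) n1"
    and "1 \<le> \<tau>" and "\<tau> \<le> \<nu>"
  shows "hermitian_self_orthogonal q (bch_code K (q ^ 2) \<beta> a 1 \<tau>) \<longleftrightarrow> a \<tau> \<le> n2 - 1"
proof -
  obtain p h where p: "prime p" "h > 0" "q = p ^ h"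
    using assms(1) by (auto simp: primepow_def)
  have char: "CHAR('a) = p"
    using assms(7) p by (intro CHAR_eq_of_card_prime_power[where k = "h * (2 * s)"])
      (auto simp: power_mult)
  have "q > 1" using primepow_gt_Suc_0[OF assms(1)] by simp
  have "s > 0" "n1 > 0" using assms(2,4,6) by auto
  have "n1 dvd q ^ (2 * s) - 1"
  proof -
    have "q ^ (2 * s) - 1 = (q ^ s + 1) * (q ^ s - 1)"
      by (simp only: mult_2 power_add) (simp add: algebra_simps)
    then show ?thesis unfolding assms(6) using mult_dvd_mono[OF dvd_refl assms(5)] by metis
  qed
  then have one: "[q ^ (2 * s) = 1] (mod n1)"
    using \<open>q > 1\<close> by (subst cong_altdef_nat) auto
  then have Qone: "[(q ^ 2) ^ s = 1] (mod n1)" by (simp add: power_mult)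
  \<comment> \<open>The length divides q^(2s) - 1, which is prime to the characteristic.\<close>
  have nz: "of_nat CARD('n) \<noteq> (0::'a)"
  proof
    assume "of_nat CARD('n) = (0::'a)"
    then have "p dvd n1" using char assms(10) of_nat_eq_0_iff_char_dvd[where 'a = 'a] by simp
    then have "p dvd q ^ (2 * s) - 1"
      using \<open>n1 dvd q ^ (2 * s) - 1\<close> dvd_trans by blast
    moreover have "p dvd q ^ (2 * s)" using p \<open>s > 0\<close> by (simp flip: power_mult)
    ultimately have "p dvd 1"
      using dvd_diffD1[of p "q ^ (2 * s)" 1] \<open>q > 1\<close> by simp
    then show False using p(1) by simp
  qed
  have \<beta>: "bij_betw \<beta> UNIV {x. x ^ CARD('n) = 1}" using assms(10,11) by simp
  then have \<beta>1: "\<beta> i ^ CARD('n) = 1" for i by (auto dest: bij_betwE)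
  define \<Delta> where "\<Delta> = (\<Union>j\<in>{1..\<tau>}. cyclotomic_coset (q ^ 2) n1 (a j))"
  have "a j \<in> min_representatives (q ^ 2) n1" if "j \<in> {1..\<tau>}" for j
    using assms(14,16) that by (auto simp flip: assms(14))
  then have "(\<Union>j\<in>{1..\<tau>}. coset_with_min (q ^ 2) CARD('n) (a j)) = \<Delta>"
    unfolding \<Delta>_def assms(10)
    using coset_with_min_eq[OF Qone \<open>s > 0\<close> \<open>n1 > 0\<close>] by simp
  then have code: "bch_code K (q ^ 2) \<beta> a 1 \<tau> = evaluation_code \<beta> \<Delta> \<inter> {x. \<forall>i. x $ i \<in> K}"
    by (simp add: bch_code_def)
  show ?thesis
  proof
    assume le: "a \<tau> \<le> n2 - 1"
    have "\<not> CARD('n) dvd e + q * f" if ef: "e \<in> \<Delta>" "f \<in> \<Delta>" for e f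
    proof -
      \<comment> \<open>The union starts at index 1, so the representatives exceed
        \<open>a 0 = 0\<close>; monotonicity bounds them by \<open>a \<tau>\<close>.\<close>
      have rep: "\<exists>i b. 0 < b \<and> b < n2 \<and> x = q ^ (2 * i) * b mod n1" if "x \<in> \<Delta>" for x
      proof -
        from that obtain j i where j: "j \<in> {1..\<tau>}" and x: "x = (q ^ 2) ^ i * a j mod n1"
          by (auto simp: \<Delta>_def cyclotomic_coset_def)
        have "a 0 < a j" using j assms(16) by (intro strict_mono_onD[OF assms(13)]) auto
        moreover have "a j \<le> a \<tau>"
          using j assms(16) strict_mono_on_leD[OF assms(13), of j \<tau>] by auto
        ultimately show ?thesis
          using le assms(4,12) x by (intro exI[of _ i] exI[of _ "a j"]) (auto simp: power_mult)
      qed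
      obtain i b where e: "0 < b" "b < n2" "e = q ^ (2 * i) * b mod n1" using rep[OF ef(1)] by blast
      obtain j c where f: "0 < c" "c < n2" "f = q ^ (2 * j) * c mod n1" using rep[OF ef(2)] by blast
      have "(e + q * f) mod n1 = (q ^ (2 * i) * b + q ^ Suc (2 * j) * c) mod n1"
        unfolding e(3) f(3) power_Suc mult.assoc by (metis mod_add_cong mod_mod_trivial mod_mult_right_eq)
      then show ?thesis
        using not_dvd_pair_sum[OF assms(6) one _ \<open>s > 0\<close> e(1,2) f(1,2), of "2 * i" "Suc (2 * j)"] \<open>q > 1\<close>
        unfolding assms(10) by (simp add: dvd_eq_mod_eq_0)
    qed
    \<comment> \<open>Orthogonality holds already over the large field and passes to the subfield
      code.\<close>
    then have "hermitian_self_orthogonal q (evaluation_code \<beta> \<Delta>)"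
      using p(3) char by (intro evaluation_code_hermitian_orthogonal[OF _ \<beta>]) auto
    then show "hermitian_self_orthogonal q (bch_code K (q ^ 2) \<beta> a 1 \<tau>)"
      unfolding code hermitian_self_orthogonal_def by blast
  next
    assume orth: "hermitian_self_orthogonal q (bch_code K (q ^ 2) \<beta> a 1 \<tau>)"
    show "a \<tau> \<le> n2 - 1"
    proof (rule ccontr)
      assume "\<not> a \<tau> \<le> n2 - 1"
      then have ge: "n2 \<le> a \<tau>" by simp
      have lt: "n2 < n1" using assms(4,6) \<open>q > 1\<close> by simp
      let ?\<Lambda> = "cyclotomic_coset (q ^ 2) n1 n2"
      have "Min ?\<Lambda> \<in> a ` {0..\<nu>}"
        using lt unfolding assms(14) min_representatives_def cyclotomic_cosets_def by simp
      then obtain j where j: "j \<le> \<nu>" "a j = Min ?\<Lambda>" by auto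
      have n2_mem: "n2 \<in> ?\<Lambda>"
        using lt unfolding cyclotomic_coset_def by (auto intro: exI[of _ 0])
      then have "Min ?\<Lambda> \<in> ?\<Lambda>" "Min ?\<Lambda> \<le> n2"
        using finite_cyclotomic_coset[OF \<open>n1 > 0\<close>] by (auto intro: Min_in)
      then have coset: "cyclotomic_coset (q ^ 2) n1 (a j) = ?\<Lambda>"
        using cyclotomic_coset_eqI[OF Qone \<open>s > 0\<close>] j(2) by simp
      \<comment> \<open>Index 0 belongs to the coset {0}, which omits the positive number
        \<open>n2\<close>.\<close>
      have "j \<noteq> 0"
      proof
        assume "j = 0"
        then have "?\<Lambda> = {0}" using coset assms(12) by (auto simp: cyclotomic_coset_def)
        then show False using n2_mem assms(4) by simp
      qed
      moreover have "j \<le> \<tau>"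
        using strict_mono_onD[OF assms(13), of \<tau> j] j \<open>Min ?\<Lambda> \<le> n2\<close> ge by fastforce
      ultimately have "?\<Lambda> \<subseteq> \<Delta>" using coset unfolding \<Delta>_def by fastforce
      moreover have "(\<Sum>k<s. z ^ ((q ^ 2) ^ k)) \<in> K" for z
        using trace_in_subfield[OF assms(8), of "h * 2" s z] assms(7,9) char p(3)
        by (simp add: power_mult)
      ultimately have C: "(\<chi> i. \<Sum>k<s. (c * \<beta> i ^ n2) ^ ((q ^ 2) ^ k)) \<in> bch_code K (q ^ 2) \<beta> a 1 \<tau>" for c
        unfolding code using trace_vector_in_evaluation_code[OF \<beta>1] assms(10) by simp
      obtain l where l: "s = Suc (2 * l)" using assms(3) by (auto elim: oddE)
      \<comment> \<open>With s = 2l + 1, the product q (q^2)^l is q^s, so the right-hand side is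
        exactly \<open>n1\<close>.\<close>
      have "CARD('n) dvd n2 + q * ((q ^ 2) ^ l * n2)"
        unfolding assms(6,10) l by (simp add: algebra_simps flip: power_mult)
      moreover have "q = CHAR('a) ^ h" "CARD('a) = (q ^ 2) ^ s" "l < s"
        using p(3) char assms(7) l by (simp_all only: power_mult)
      ultimately have "\<not> hermitian_self_orthogonal q (bch_code K (q ^ 2) \<beta> a 1 \<tau>)"
        by (intro trace_vectors_not_orthogonal[OF _ \<open>q > 1\<close> refl _ \<beta> nz _ _ C])
      then show False using orth by blast
    qed
  qed
qed

end
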